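(* Let $G$ be a uniquely $2$-divisible group and, for $x,y\in G$, put $x\circ y = xy[y,x]^{1/2}$. Then $G$ is $2$-Engel if and only if $(G,\circ)$ is a commutative Moufang loop.
   Context: A group $G$ is uniquely $2$-divisible if the map $x\mapsto x^2$ is a bijection of $G$; $a^{1/2}$ denotes the unique $b\in G$ with $b^2=a$. Commutators are $[x,y]=x^{-1}y^{-1}xy$, and $[x,y,z]=[[x,y],z]$. A group $G$ is $2$-Engel if $[x,y,y]=1$ for all $x,y\in G$. A loop is a set $Q$ with a binary operation such that for all $a,b\in Q$ the equations $ax=b$ and $ya=b$ have unique solutions $x,y\in Q$, and there is $1\in Q$ with $1x=x1=x$ for all $x\in Q$. For every uniquely $2$-divisible group $G$, $(G,\circ)$ is known to be a commutative loop with neutral element $1$, and powers in $G$ and $(G,\circ)$ coincide. A loop is Moufang if $(xy)(zx)=x((yz)x)$ for all $x,y,z$. *)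

theory Defs
  imports "HOL-Algebra.Group"
begin

definition uniquely_2_divisible :: "('a, 'b) monoid_scheme \<Rightarrow> bool" where
  "uniquely_2_divisible G \<longleftrightarrow>
     bij_betw (\<lambda>x. x [^]\<^bsub>G\<^esub> (2::nat)) (carrier G) (carrier G)"

text \<open>Only meaningful for \<open>a\<close> in the carrier of a uniquely 2-divisible group.\<close>
definition group_sqrt :: "('a, 'b) monoid_scheme \<Rightarrow> 'a \<Rightarrow> 'a" where
  "group_sqrt G a = (THE b. b \<in> carrier G \<and> b [^]\<^bsub>G\<^esub> (2::nat) = a)"

text \<open>The convention is \<open>[x,y] = x\<inverse>y\<inverse>xy\<close>, unlike the generators
  \<open>xyx\<inverse>y\<inverse>\<close> used for derived subgroups in \<open>HOL-Algebra\<close>.\<close>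
definition group_commutator :: "('a, 'b) monoid_scheme \<Rightarrow> 'a \<Rightarrow> 'a \<Rightarrow> 'a" where
  "group_commutator G x y = inv\<^bsub>G\<^esub> x \<otimes>\<^bsub>G\<^esub> inv\<^bsub>G\<^esub> y \<otimes>\<^bsub>G\<^esub> x \<otimes>\<^bsub>G\<^esub> y"

definition two_Engel :: "('a, 'b) monoid_scheme \<Rightarrow> bool" where
  "two_Engel G \<longleftrightarrow>
     (\<forall>x\<in>carrier G. \<forall>y\<in>carrier G.
        group_commutator G (group_commutator G x y) y = \<one>\<^bsub>G\<^esub>)"

text \<open>Loops reuse the \<open>monoid\<close> record of \<open>HOL-Algebra\<close> purely as a signature
  (carrier, multiplication, neutral element); associativity is not assumed.\<close>
locale loop =
  fixes Q (structure)
  assumes m_closed: "\<lbrakk>x \<in> carrier Q; y \<in> carrier Q\<rbrakk> \<Longrightarrow> x \<otimes> y \<in> carrier Q"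
    and one_closed: "\<one> \<in> carrier Q"
    and l_one: "x \<in> carrier Q \<Longrightarrow> \<one> \<otimes> x = x"
    and r_one: "x \<in> carrier Q \<Longrightarrow> x \<otimes> \<one> = x"
    and left_division: "\<lbrakk>a \<in> carrier Q; b \<in> carrier Q\<rbrakk> \<Longrightarrow> \<exists>!x. x \<in> carrier Q \<and> a \<otimes> x = b"
    and right_division: "\<lbrakk>a \<in> carrier Q; b \<in> carrier Q\<rbrakk> \<Longrightarrow> \<exists>!y. y \<in> carrier Q \<and> y \<otimes> a = b"

locale comm_loop = loop +
  assumes m_comm: "\<lbrakk>x \<in> carrier Q; y \<in> carrier Q\<rbrakk> \<Longrightarrow> x \<otimes> y = y \<otimes> x"

locale moufang_loop = loop +
  assumes moufang: "\<lbrakk>x \<in> carrier Q; y \<in> carrier Q; z \<in> carrier Q\<rbrakk> \<Longrightarrow>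
    (x \<otimes> y) \<otimes> (z \<otimes> x) = x \<otimes> ((y \<otimes> z) \<otimes> x)"

locale comm_moufang_loop = comm_loop + moufang_loop

definition circ :: "('a, 'b) monoid_scheme \<Rightarrow> 'a \<Rightarrow> 'a \<Rightarrow> 'a" where
  "circ G x y = x \<otimes>\<^bsub>G\<^esub> y \<otimes>\<^bsub>G\<^esub> group_sqrt G (group_commutator G y x)"

definition circ_loop :: "('a, 'b) monoid_scheme \<Rightarrow> 'a monoid" where
  "circ_loop G = \<lparr>carrier = carrier G, mult = circ G, one = \<one>\<^bsub>G\<^esub>\<rparr>"

end

theory Submission
  imports Defs
begin

text \<open>
  In every uniquely 2-divisible group \<open>x\<inverse> \<circ> (xyx) = x \<circ> y\<close>. If \<open>\<circ>\<close> is commutative Moufang, then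
  the inverse and alternative laws turn this into \<open>xyx = x\<^sup>2 \<circ> y\<close>, that is
  \<open>[y,x\<^sup>2] = [y,x]\<^sup>2\<close>, which says that \<open>[y,x]\<close> commutes with \<open>x\<close>.

  Conversely, in a 2-Engel group \<open>u\<^sup>2 \<circ> y = uyu\<close>, so division is clear, and for \<open>x = u\<^sup>2\<close>,
  \<open>y = v\<^sup>2\<close> one has \<open>x \<circ> y = t\<^sup>2\<close> with \<open>t = uvc\<close>, \<open>c = [v,u]\<^sup>1\<^sup>/\<^sup>2\<close>. The Moufang law becomes
  \<open>t(uzu)t = u\<^sup>2(vzv)u\<^sup>2\<close>, and since \<open>tu = u\<^sup>2vc\<^sup>3\<close> and \<open>c\<^sup>3ut = vu\<^sup>2\<close> it amounts to \<open>c\<^sup>3\<close> commuting with \<open>z\<close>.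
  This follows from Levi's identity \<open>[x,y,z]\<^sup>3 = 1\<close>.
\<close>

section \<open>Commutator identities valid in every group\<close>

context group
begin

lemma l_cancel_inv [simp]:
  "\<lbrakk>x \<in> carrier G; y \<in> carrier G\<rbrakk> \<Longrightarrow> inv x \<otimes> (x \<otimes> y) = y"
  by (simp flip: m_assoc)

lemma l_cancel_inv' [simp]:
  "\<lbrakk>x \<in> carrier G; y \<in> carrier G\<rbrakk> \<Longrightarrow> x \<otimes> (inv x \<otimes> y) = y"
  by (simp flip: m_assoc)

lemma commutator_closed [simp]:
  "\<lbrakk>x \<in> carrier G; y \<in> carrier G\<rbrakk> \<Longrightarrow> group_commutator G x y \<in> carrier G"
  by (simp add: group_commutator_def)

lemma commutator_eq_one_iff:
  assumes "x \<in> carrier G" "y \<in> carrier G"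
  shows "group_commutator G x y = \<one> \<longleftrightarrow> x \<otimes> y = y \<otimes> x"
proof -
  have "group_commutator G x y = inv (y \<otimes> x) \<otimes> (x \<otimes> y)"
    using assms by (simp add: group_commutator_def m_assoc inv_mult_group)
  then show ?thesis
    using assms inv_solve_left[of \<one> "y \<otimes> x" "x \<otimes> y"] by (auto simp: eq_commute)
qed

lemma inv_commutator:
  "\<lbrakk>x \<in> carrier G; y \<in> carrier G\<rbrakk> \<Longrightarrow> inv (group_commutator G x y) = group_commutator G y x"
  by (simp add: group_commutator_def m_assoc inv_mult_group)

lemma commute_inv:
  assumes "x \<in> carrier G" "y \<in> carrier G" "x \<otimes> y = y \<otimes> x"
  shows "inv x \<otimes> y = y \<otimes> inv x"
proof -
  have "inv x \<otimes> y = inv x \<otimes> (y \<otimes> x) \<otimes> inv x"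
    using assms(1,2) by (simp add: m_assoc)
  also have "\<dots> = y \<otimes> inv x"
    using assms(1,2) by (simp flip: assms(3))
  finally show ?thesis .
qed

text \<open>The Hall-Witt identity: the expanded word cancels freely. Its three factors are the
  source of the exponent 3 in Levi's identity.\<close>

lemma hall_witt:
  assumes "x \<in> carrier G" "y \<in> carrier G" "z \<in> carrier G"
  shows "(inv y \<otimes> group_commutator G (group_commutator G x (inv y)) z \<otimes> y)
    \<otimes> (inv z \<otimes> group_commutator G (group_commutator G y (inv z)) x \<otimes> z)
    \<otimes> (inv x \<otimes> group_commutator G (group_commutator G z (inv x)) y \<otimes> x) = \<one>"
  using assms by (simp add: group_commutator_def m_assoc inv_mult_group)

end

section \<open>Square roots, the operation \<open>circ\<close>, and the Engel law derived from the
  Moufang law\<close>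

locale uniquely_2_divisible_group = group +
  assumes uniquely_2_divisible: "uniquely_2_divisible G"
begin

lemma square_inj:
  assumes "x \<in> carrier G" "y \<in> carrier G" "x \<otimes> x = y \<otimes> y"
  shows "x = y"
proof (rule inj_onD)
  show "inj_on (\<lambda>x. x [^] (2::nat)) (carrier G)"
    using uniquely_2_divisible by (simp add: uniquely_2_divisible_def bij_betw_def)
  show "x [^] (2::nat) = y [^] (2::nat)"
    using assms by (simp add: numeral_2_eq_2)
qed (use assms in auto)

lemma ex_square_root:
  assumes "x \<in> carrier G"
  obtains y where "y \<in> carrier G" "y \<otimes> y = x"
proof -
  have "x \<in> (\<lambda>x. x [^] (2::nat)) ` carrier G"
    using assms uniquely_2_divisible by (simp add: uniquely_2_divisible_def bij_betw_def)
  then show ?thesis using that by (auto simp: numeral_2_eq_2)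
qed

lemma group_sqrt_square:
  assumes "x \<in> carrier G"
  shows "group_sqrt G (x \<otimes> x) = x"
proof -
  have "b = x" if "b \<in> carrier G \<and> b [^] (2::nat) = x \<otimes> x" for b
    using that assms square_inj[of b x] by (auto simp: numeral_2_eq_2)
  then show ?thesis
    unfolding group_sqrt_def using assms by (intro the_equality) (auto simp: numeral_2_eq_2)
qed

lemma group_sqrt_closed [simp]: "x \<in> carrier G \<Longrightarrow> group_sqrt G x \<in> carrier G"
  by (rule ex_square_root[of x]) (auto simp: group_sqrt_square)

lemma square_group_sqrt:
  "x \<in> carrier G \<Longrightarrow> group_sqrt G x \<otimes> group_sqrt G x = x"
  by (rule ex_square_root[of x]) (auto simp: group_sqrt_square)

text \<open>By the hypothesis \<open>x\<close> and its conjugate by \<open>y\<close> have the same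
  square, hence coincide.\<close>

lemma commute_square_root:
  assumes "x \<in> carrier G" "y \<in> carrier G" "(x \<otimes> x) \<otimes> y = y \<otimes> (x \<otimes> x)"
  shows "x \<otimes> y = y \<otimes> x"
proof -
  have "x = inv y \<otimes> x \<otimes> y"
  proof (rule square_inj)
    have "(inv y \<otimes> x \<otimes> y) \<otimes> (inv y \<otimes> x \<otimes> y) = inv y \<otimes> ((x \<otimes> x) \<otimes> y)"
      using assms(1,2) by (simp add: m_assoc)
    then show "x \<otimes> x = inv y \<otimes> x \<otimes> y \<otimes> (inv y \<otimes> x \<otimes> y)"
      using assms by (simp add: m_assoc)
  qed (use assms in auto)
  then show ?thesis
    using assms inv_solve_left[of x y "x \<otimes> y"] by (simp add: m_assoc)
qed

lemma circ_closed [simp]: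
  "\<lbrakk>x \<in> carrier G; y \<in> carrier G\<rbrakk> \<Longrightarrow> circ G x y \<in> carrier G"
  by (simp add: circ_def)

lemma circ_of_commuting:
  assumes "x \<in> carrier G" "y \<in> carrier G" "x \<otimes> y = y \<otimes> x"
  shows "circ G x y = x \<otimes> y"
proof -
  \<comment> \<open>\<open>\<one>\<close> is written as its own square so that its root can be read
    off.\<close>
  have "group_commutator G y x = \<one> \<otimes> \<one>"
    using assms commutator_eq_one_iff by simp
  then show ?thesis
    unfolding circ_def using assms(1,2) group_sqrt_square[of \<one>] by simp
qed

text \<open>If \<open>s\<close> is the root of [y,x], then \<open>inv s\<close> is the root of
  [x,y], while yx = xy s^2; so both products equal xys.\<close>

lemma circ_commute:
  assumes "x \<in> carrier G" "y \<in> carrier G"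
  shows "circ G x y = circ G y x"
proof -
  define s where "s = group_sqrt G (group_commutator G y x)"
  have s: "s \<in> carrier G" "s \<otimes> s = group_commutator G y x"
    using assms by (simp_all add: s_def square_group_sqrt)
  have "group_commutator G x y = inv s \<otimes> inv s"
    using assms s inv_commutator[of y x] inv_mult_group[of s s] by simp
  then have "group_sqrt G (group_commutator G x y) = inv s"
    using s group_sqrt_square by simp
  moreover have "y \<otimes> x = x \<otimes> y \<otimes> (s \<otimes> s)"
    using assms s by (simp add: group_commutator_def m_assoc)
  ultimately show ?thesis
    using assms s(1) by (simp add: circ_def m_assoc flip: s_def)
qed

text \<open>Since [xyx, x^-1] = [x,y], the left side is yx[x,y]^(1/2), which is
  \<open>circ G y x\<close>.\<close>

lemma circ_inv_conj:
  assumes "x \<in> carrier G" "y \<in> carrier G"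
  shows "circ G (inv x) (x \<otimes> y \<otimes> x) = circ G x y"
proof -
  have "group_commutator G (x \<otimes> y \<otimes> x) (inv x) = group_commutator G x y"
    using assms by (simp add: group_commutator_def m_assoc inv_mult_group)
  then have "circ G (inv x) (x \<otimes> y \<otimes> x) = circ G y x"
    using assms by (simp add: circ_def m_assoc)
  then show ?thesis
    using circ_commute[OF assms] by simp
qed

lemma two_Engel_of_moufang:
  assumes "comm_moufang_loop (circ_loop G)"
  shows "two_Engel G"
proof -
  interpret Q: comm_moufang_loop "circ_loop G" by fact
  \<comment> \<open>Inverse property: with \<open>inv x\<close> as second entry, the left side of
    the Moufang law collapses to \<open>circ G y x\<close>; unique division then cancels one factor
    \<open>x\<close>.\<close>
  have circ_inv: "circ G x (circ G (inv x) y) = y"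
    if x: "x \<in> carrier G" and y: "y \<in> carrier G" for x y
  proof -
    have "circ G (circ G x (inv x)) (circ G y x) = circ G x (circ G (circ G (inv x) y) x)"
      using Q.moufang[of x "inv x" y] x y by (simp add: circ_loop_def)
    then have "circ G x y = circ G x (circ G x (circ G (inv x) y))"
      using x y Q.l_one[of "circ G y x"] circ_commute[of y x] circ_commute[of "circ G (inv x) y" x]
      by (simp add: circ_of_commuting circ_loop_def)
    moreover have "\<exists>!w. w \<in> carrier G \<and> circ G x w = circ G x y"
      using Q.left_division[of x "circ G x y"] x y by (simp add: circ_loop_def)
    moreover have "circ G x (circ G (inv x) y) \<in> carrier G"
      using x y by simp
    ultimately show ?thesis
      using y by metis
  qed
  have circ_square: "circ G x (circ G x y) = circ G (x \<otimes> x) y"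
    if x: "x \<in> carrier G" and y: "y \<in> carrier G" for x y
  proof -
    \<comment> \<open>With \<open>circ G x z = y\<close>, the Moufang law for \<open>x\<close>,
      \<open>x\<close>, \<open>z\<close> becomes the alternative law.\<close>
    define z where "z = circ G (inv x) y"
    have z: "z \<in> carrier G" "circ G x z = y"
      using x y circ_inv by (simp_all add: z_def)
    have "circ G (circ G x x) (circ G z x) = circ G x (circ G (circ G x z) x)"
      using Q.moufang[of x x z] x z by (simp add: circ_loop_def)
    then show ?thesis
      using x y z circ_commute[of z x] circ_commute[of y x] by (simp add: circ_of_commuting)
  qed
  have "group_commutator G (group_commutator G y x) x = \<one>"
    if x: "x \<in> carrier G" and y: "y \<in> carrier G" for x y
  proof -
    \<comment> \<open>Both sides are \<open>circ G x (circ G x y)\<close>: the left by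
      alternativity, the right by replacing the inner product via \<open>circ_inv_conj\<close> and
      cancelling with \<open>circ_inv\<close>.\<close>
    have "circ G (x \<otimes> x) y = x \<otimes> y \<otimes> x"
      using circ_square[OF x y] circ_inv[OF x, of "x \<otimes> y \<otimes> x"] circ_inv_conj[OF x y] x y by simp
    then have "x \<otimes> x \<otimes> y \<otimes> group_sqrt G (group_commutator G y (x \<otimes> x))
        = x \<otimes> x \<otimes> y \<otimes> group_commutator G y x"
      using x y by (simp add: circ_def group_commutator_def m_assoc)
    then have "group_sqrt G (group_commutator G y (x \<otimes> x)) = group_commutator G y x"
      using x y by simp
    then have "group_commutator G y (x \<otimes> x) = group_commutator G y x \<otimes> group_commutator G y x"
      using x y square_group_sqrt[of "group_commutator G y (x \<otimes> x)"] by simp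
    \<comment> \<open>Comparison with this expansion, valid in any group, shows that conjugation by
      \<open>x\<close> fixes [y,x].\<close>
    moreover have "group_commutator G y (x \<otimes> x)
        = group_commutator G y x \<otimes> (inv x \<otimes> (group_commutator G y x \<otimes> x))"
      using x y by (simp add: group_commutator_def m_assoc inv_mult_group)
    ultimately have "group_commutator G y x = inv x \<otimes> (group_commutator G y x \<otimes> x)"
      using x y by simp
    then show ?thesis
      using x y inv_solve_left[of "group_commutator G y x" x "group_commutator G y x \<otimes> x"]
      by (simp add: commutator_eq_one_iff)
  qed
  then show ?thesis
    by (simp add: two_Engel_def)
qed

end

section \<open>Commuting conjugates and Levi's identity in 2-Engel groups\<close>

locale two_Engel_group = group +
  assumes two_Engel: "two_Engel G"
begin

lemma commutator_commute_right:
  "\<lbrakk>x \<in> carrier G; y \<in> carrier G\<rbrakk> \<Longrightarrow>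
    group_commutator G x y \<otimes> y = y \<otimes> group_commutator G x y"
  using two_Engel commutator_eq_one_iff by (simp add: two_Engel_def)

text \<open>[x,y] is the inverse of [y,x], which commutes with its second entry
  \<open>x\<close>.\<close>

lemma commutator_commute_left:
  "\<lbrakk>x \<in> carrier G; y \<in> carrier G\<rbrakk> \<Longrightarrow>
    group_commutator G x y \<otimes> x = x \<otimes> group_commutator G x y"
  using commutator_commute_right[of y x] commute_inv[of "group_commutator G y x" x] inv_commutator[of y x]
  by simp

text \<open>In any group [x,y^-1] is a conjugate of [x,y]^-1 by a power of \<open>y\<close>, and
  here \<open>y\<close> commutes with [x,y].\<close>

lemma commutator_inv_right:
  assumes "x \<in> carrier G" "y \<in> carrier G"
  shows "group_commutator G x (inv y) = inv (group_commutator G x y)"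
proof -
  have "group_commutator G x (inv y) = y \<otimes> (inv (group_commutator G x y) \<otimes> inv y)"
    using assms by (simp add: group_commutator_def m_assoc inv_mult_group)
  also have "\<dots> = (y \<otimes> inv (group_commutator G x y)) \<otimes> inv y"
    using assms by (simp add: m_assoc)
  also have "\<dots> = (inv (group_commutator G x y) \<otimes> y) \<otimes> inv y"
    using assms commute_inv[OF _ _ commutator_commute_right[OF assms]] by simp
  finally show ?thesis
    using assms by (simp add: m_assoc)
qed

lemma commutator_inv_left:
  assumes "x \<in> carrier G" "y \<in> carrier G"
  shows "group_commutator G (inv x) y = inv (group_commutator G x y)"
  using assms commutator_inv_right[of y x] inv_commutator[of y "inv x"] inv_commutator[of y x] inv_commutator[of x y]
  by simp

text \<open>The conjugate is x[x,g], and [x,g] commutes with \<open>x\<close>.\<close>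

lemma commute_conjugate:
  assumes "x \<in> carrier G" "g \<in> carrier G"
  shows "(inv g \<otimes> x \<otimes> g) \<otimes> x = x \<otimes> (inv g \<otimes> x \<otimes> g)"
proof -
  have "inv g \<otimes> x \<otimes> g = x \<otimes> group_commutator G x g"
    using assms by (simp add: group_commutator_def m_assoc)
  then show ?thesis
    using assms commutator_commute_left[OF assms] by (simp add: m_assoc)
qed

text \<open>Conjugating by \<open>h\<close> reduces this to \<open>x\<close> and its conjugate by g
  h^-1.\<close>

lemma conjugates_commute:
  assumes "x \<in> carrier G" "g \<in> carrier G" "h \<in> carrier G"
  shows "(inv g \<otimes> x \<otimes> g) \<otimes> (inv h \<otimes> x \<otimes> h) = (inv h \<otimes> x \<otimes> h) \<otimes> (inv g \<otimes> x \<otimes> g)"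
proof -
  let ?k = "g \<otimes> inv h"
  have "(inv g \<otimes> x \<otimes> g) \<otimes> (inv h \<otimes> x \<otimes> h) = inv h \<otimes> ((inv ?k \<otimes> x \<otimes> ?k) \<otimes> x) \<otimes> h"
    using assms by (simp add: m_assoc inv_mult_group)
  also have "\<dots> = inv h \<otimes> (x \<otimes> (inv ?k \<otimes> x \<otimes> ?k)) \<otimes> h"
    using assms commute_conjugate[of x ?k] by simp
  also have "\<dots> = (inv h \<otimes> x \<otimes> h) \<otimes> (inv g \<otimes> x \<otimes> g)"
    using assms by (simp add: m_assoc inv_mult_group)
  finally show ?thesis .
qed

text \<open>With a = [x,g], conjugation by \<open>g\<close> gives xa and conjugation by g^-1 gives x
  a^-1, where \<open>a\<close> commutes with \<open>x\<close>.\<close>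

lemma conjugate_inv_eq:
  assumes "x \<in> carrier G" "g \<in> carrier G"
  shows "g \<otimes> x \<otimes> inv g = inv (inv g \<otimes> x \<otimes> g) \<otimes> (x \<otimes> x)"
proof -
  let ?a = "group_commutator G x g"
  have conj: "inv g \<otimes> x \<otimes> g = x \<otimes> ?a"
    using assms by (simp add: group_commutator_def m_assoc)
  have "g \<otimes> x \<otimes> inv g = x \<otimes> group_commutator G x (inv g)"
    using assms by (simp add: group_commutator_def m_assoc)
  also have "\<dots> = inv ?a \<otimes> x"
    using assms commutator_inv_right commute_inv[OF _ _ commutator_commute_left[OF assms]] by simp
  also have "\<dots> = inv (x \<otimes> ?a) \<otimes> (x \<otimes> x)"
    using assms by (simp add: m_assoc inv_mult_group)
  finally show ?thesis
    by (simp add: conj)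
qed

text \<open>Together with antisymmetry in the first two entries, this makes triple commutators
  invariant under cyclic rotation.\<close>

lemma commutator_swap:
  assumes x: "x \<in> carrier G" and y: "y \<in> carrier G" and z: "z \<in> carrier G"
  shows "group_commutator G (group_commutator G x y) z
    \<otimes> group_commutator G (group_commutator G x z) y = \<one>"
proof -
  \<comment> \<open>\<open>Z\<close> is the double centralizer of the conjugates of \<open>x\<close>: abelian, since these conjugates
    commute with one another.\<close>
  define C where
    "C = {c \<in> carrier G. \<forall>g\<in>carrier G. c \<otimes> (inv g \<otimes> x \<otimes> g) = (inv g \<otimes> x \<otimes> g) \<otimes> c}"
  define Z where "Z = {n \<in> carrier G. \<forall>c\<in>C. n \<otimes> c = c \<otimes> n}"
  have conj_C: "inv g \<otimes> x \<otimes> g \<in> C" if "g \<in> carrier G" for g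
    unfolding C_def using x that conjugates_commute by simp
  have conj_Z: "inv g \<otimes> x \<otimes> g \<in> Z" if "g \<in> carrier G" for g
    using x that by (simp add: Z_def C_def)
  have Z_carrier: "n \<in> carrier G" if "n \<in> Z" for n
    using that by (simp add: Z_def)
  \<comment> \<open>The conjugates of \<open>x\<close> lie in \<open>C\<close>, so whatever
    centralizes \<open>C\<close> centralizes them; thus \<open>Z\<close> lies in \<open>C\<close>
    and centralizes itself.\<close>
  have Z_C: "n \<in> C" if n: "n \<in> Z" for n
    unfolding C_def
  proof (intro CollectI conjI ballI)
    fix g assume "g \<in> carrier G"
    then show "n \<otimes> (inv g \<otimes> x \<otimes> g) = (inv g \<otimes> x \<otimes> g) \<otimes> n"
      using n conj_C[of g] unfolding Z_def by blast
  qed (rule Z_carrier[OF n])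
  have Z_commute: "n \<otimes> m = m \<otimes> n" if "n \<in> Z" "m \<in> Z" for n m
    using that Z_C[of m] unfolding Z_def by blast
  have Z_lcommute: "n \<otimes> (m \<otimes> k) = m \<otimes> (n \<otimes> k)"
    if "n \<in> Z" "m \<in> Z" "k \<in> carrier G" for n m k
    using that Z_carrier Z_commute[of n m] by (simp flip: m_assoc)
  have C_carrier: "c \<in> carrier G" if "c \<in> C" for c
    using that by (simp add: C_def)
  have Z_inv: "inv n \<in> Z" if "n \<in> Z" for n
    using that C_carrier commute_inv by (simp add: Z_def)
  \<comment> \<open>The conjugates of \<open>x\<close> by y, z, yz and zy; together with
    \<open>x\<close> they suffice to write both triple commutators.\<close>
  define p where "p = inv y \<otimes> x \<otimes> y"
  define q where "q = inv z \<otimes> x \<otimes> z"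
  define r where "r = inv z \<otimes> p \<otimes> z"
  define s where "s = inv y \<otimes> q \<otimes> y"
  have r: "r = inv (y \<otimes> z) \<otimes> x \<otimes> (y \<otimes> z)"
    and s: "s = inv (z \<otimes> y) \<otimes> x \<otimes> (z \<otimes> y)"
    using x y z by (simp_all add: p_def q_def r_def s_def m_assoc inv_mult_group)
  have Z: "x \<in> Z" "p \<in> Z" "q \<in> Z" "r \<in> Z" "s \<in> Z"
    using conj_Z[of \<one>] conj_Z x y z r s by (simp_all add: p_def q_def)
  note Z' = Z Z[THEN Z_inv]
  note carr = x y z Z'[THEN Z_carrier]
  let ?w = "inv p \<otimes> x \<otimes> inv q \<otimes> r \<otimes> (inv q \<otimes> x \<otimes> inv p \<otimes> s)"
  \<comment> \<open>Written additively in \<open>Z\<close>, every \<open>g\<close> acts with \<open>g + g\<inverse> = 2\<close>; expanding this for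
    \<open>g = yz\<close> gives \<open>(y - 1)(z - 1) + (z - 1)(y - 1) = 0\<close>.\<close>
  have y_conj_x: "y \<otimes> x \<otimes> inv y = inv p \<otimes> (x \<otimes> x)"
    using conjugate_inv_eq[OF x y] by (simp add: p_def)
  have y_conj_q: "y \<otimes> q \<otimes> inv y = inv s \<otimes> (q \<otimes> q)"
    using conjugate_inv_eq[of q y] carr by (simp add: s_def)
  \<comment> \<open>The conjugate of \<open>x\<close> by (yz)^-1 is computed twice: directly, and by
    z^-1 followed by y^-1.\<close>
  have "inv r \<otimes> (x \<otimes> x) = y \<otimes> (z \<otimes> x \<otimes> inv z) \<otimes> inv y"
    using conjugate_inv_eq[of x "y \<otimes> z"] r x y z by (simp add: m_assoc inv_mult_group)
  also have "\<dots> = y \<otimes> (inv q \<otimes> (x \<otimes> x)) \<otimes> inv y"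
    using conjugate_inv_eq[OF x z] by (simp add: q_def)
  also have "\<dots> = inv (y \<otimes> q \<otimes> inv y) \<otimes> (y \<otimes> x \<otimes> inv y) \<otimes> (y \<otimes> x \<otimes> inv y)"
    using carr by (simp add: m_assoc inv_mult_group)
  also have "\<dots> = inv (inv s \<otimes> (q \<otimes> q)) \<otimes> (inv p \<otimes> (x \<otimes> x)) \<otimes> (inv p \<otimes> (x \<otimes> x))"
    by (simp only: y_conj_x y_conj_q)
  finally have "x \<otimes> x = r \<otimes>
      (inv (inv s \<otimes> (q \<otimes> q)) \<otimes> (inv p \<otimes> (x \<otimes> x)) \<otimes> (inv p \<otimes> (x \<otimes> x)))"
    using carr by (subst (asm) inv_solve_left') simp_all
  \<comment> \<open>As \<open>Z\<close> is abelian, both sides collect to r s x^4 p^-2 q^-2.\<close>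
  also have "\<dots> = ?w \<otimes> (x \<otimes> x)"
    using carr Z' by (simp add: m_assoc inv_mult_group Z_commute Z_lcommute)
  finally have "?w = \<one>"
    using carr r_cancel_one[of "x \<otimes> x" ?w] by simp
  moreover have "group_commutator G (group_commutator G x y) z = inv p \<otimes> x \<otimes> inv q \<otimes> r"
    "group_commutator G (group_commutator G x z) y = inv q \<otimes> x \<otimes> inv p \<otimes> s"
    using x y z by (simp_all add: group_commutator_def p_def q_def r_def s_def m_assoc inv_mult_group)
  ultimately show ?thesis by simp
qed

text \<open>Swapping the last two entries and swapping the first two each invert the
  commutator.\<close>

lemma commutator_rotate:
  assumes "x \<in> carrier G" "y \<in> carrier G" "z \<in> carrier G"
  shows "group_commutator G (group_commutator G z x) y = group_commutator G (group_commutator G x y) z"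
proof -
  have "group_commutator G (group_commutator G x z) y
      = inv (group_commutator G (group_commutator G z x) y)"
    using assms inv_commutator[of z x] commutator_inv_left[of "group_commutator G z x" y] by simp
  then show ?thesis
    using commutator_swap[OF assms] assms inv_equality[of _ "inv (group_commutator G (group_commutator G z x) y)"]
    by simp
qed

lemma commutator3_commute:
  assumes "x \<in> carrier G" "y \<in> carrier G" "z \<in> carrier G"
  shows "group_commutator G (group_commutator G x y) z \<otimes> z
    = z \<otimes> group_commutator G (group_commutator G x y) z"
  using assms by (intro commutator_commute_right) simp_all

text \<open>Levi's identity: in the Hall-Witt identity the inverted entries pull out, the three
  rotations agree and the outer conjugations disappear, leaving k^-3 = 1.\<close>

lemma commutator3_cube:
  assumes x: "x \<in> carrier G" and y: "y \<in> carrier G" and z: "z \<in> carrier G"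
  defines "k \<equiv> group_commutator G (group_commutator G x y) z"
  shows "k \<otimes> k \<otimes> k = \<one>"
proof -
  have k: "k \<in> carrier G"
    using x y z by (simp add: k_def)
  have k_rot: "group_commutator G (group_commutator G z x) y = k"
    "group_commutator G (group_commutator G y z) x = k"
    using commutator_rotate[OF x y z] commutator_rotate[OF y z x] by (simp_all add: k_def)
  \<comment> \<open>By rotation each of \<open>x\<close>, \<open>y\<close>, \<open>z\<close> can be
    made the last entry of \<open>k\<close>, with which \<open>k\<close> commutes.\<close>
  have k_commute: "k \<otimes> g = g \<otimes> k" if "g \<in> {x, y, z}" for g
    using that commutator3_commute[OF x y z] commutator3_commute[OF z x y]
      commutator3_commute[OF y z x] k_rot by (auto simp: k_def)
  have conj: "inv g \<otimes> inv k \<otimes> g = inv k" if g: "g \<in> {x, y, z}" for g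
  proof -
    have "g \<in> carrier G" using g x y z by auto
    then show ?thesis
      using k commute_inv[OF _ _ k_commute[OF g]] by (simp add: m_assoc)
  qed
  have inv_inner: "group_commutator G (group_commutator G a (inv b)) c
      = inv (group_commutator G (group_commutator G a b) c)"
    if "a \<in> carrier G" "b \<in> carrier G" "c \<in> carrier G" for a b c
    using that by (simp add: commutator_inv_right commutator_inv_left)
  have "inv k \<otimes> inv k \<otimes> inv k = \<one>"
    using hall_witt[OF x y z] x y z conj by (simp add: inv_inner k_rot flip: k_def)
  then have "inv (k \<otimes> k \<otimes> k) = \<one>"
    using k by (simp add: inv_mult_group m_assoc)
  then show ?thesis
    using k by (simp add: inv_eq_1_iff)
qed

text \<open>Moving \<open>z\<close> left past each \<open>a\<close> releases one k = [a,z]; as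
  \<open>k\<close> commutes with \<open>a\<close>, three moves release k^3 = 1.\<close>

lemma commutator_cube_commute:
  assumes x: "x \<in> carrier G" and y: "y \<in> carrier G" and z: "z \<in> carrier G"
  defines "a \<equiv> group_commutator G x y"
  shows "(a \<otimes> a \<otimes> a) \<otimes> z = z \<otimes> (a \<otimes> a \<otimes> a)"
proof -
  have a: "a \<in> carrier G"
    using x y by (simp add: a_def)
  define k where "k = group_commutator G a z"
  have k: "k \<in> carrier G"
    using a z by (simp add: k_def)
  have az: "a \<otimes> z = z \<otimes> (a \<otimes> k)"
    using a z by (simp add: k_def group_commutator_def m_assoc)
  have ka: "k \<otimes> a = a \<otimes> k"
    using a z commutator_commute_left by (simp add: k_def)
  have ka': "k \<otimes> (a \<otimes> w) = a \<otimes> (k \<otimes> w)" if "w \<in> carrier G" for w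
    using a k ka that by (simp flip: m_assoc)
  have az': "a \<otimes> (z \<otimes> w) = z \<otimes> (a \<otimes> (k \<otimes> w))" if "w \<in> carrier G" for w
  proof -
    have "a \<otimes> (z \<otimes> w) = (a \<otimes> z) \<otimes> w"
      using a z that by (simp add: m_assoc)
    then show ?thesis
      using a k z that by (simp add: az m_assoc)
  qed
  have "(a \<otimes> a \<otimes> a) \<otimes> z = z \<otimes> (a \<otimes> a \<otimes> a) \<otimes> (k \<otimes> k \<otimes> k)"
    using a k z by (simp add: m_assoc az az' ka ka')
  then show ?thesis
    using a z commutator3_cube[OF x y z] by (simp add: k_def a_def)
qed

end

section \<open>The Moufang law for \<open>circ\<close> in uniquely 2-divisible 2-Engel
  groups\<close>

locale uniquely_2_divisible_two_Engel_group = uniquely_2_divisible_group + two_Engel_group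
begin

text \<open>Since [y,u] commutes with \<open>u\<close>, [y,u^2] = [y,u]^2, whose root is
  [y,u].\<close>

lemma circ_square:
  assumes "u \<in> carrier G" "y \<in> carrier G"
  shows "circ G (u \<otimes> u) y = u \<otimes> y \<otimes> u"
proof -
  let ?a = "group_commutator G y u"
  have "group_commutator G y (u \<otimes> u) = ?a \<otimes> (inv u \<otimes> (?a \<otimes> u))"
    using assms by (simp add: group_commutator_def m_assoc inv_mult_group)
  also have "\<dots> = ?a \<otimes> ?a"
    using assms commutator_commute_right[of y u] by simp
  finally have "group_sqrt G (group_commutator G y (u \<otimes> u)) = ?a"
    using assms group_sqrt_square by simp
  then show ?thesis
    using assms by (simp add: circ_def) (simp add: group_commutator_def m_assoc)
qed

lemma circ_moufang_squares:
  assumes u: "u \<in> carrier G" and v: "v \<in> carrier G" and z: "z \<in> carrier G"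
  shows "circ G (circ G (u \<otimes> u) (v \<otimes> v)) (circ G z (u \<otimes> u))
    = circ G (u \<otimes> u) (circ G (circ G (v \<otimes> v) z) (u \<otimes> u))"
proof -
  define c where "c = group_sqrt G (group_commutator G v u)"
  have c: "c \<in> carrier G" and cc: "c \<otimes> c = group_commutator G v u"
    using u v square_group_sqrt by (simp_all add: c_def)
  \<comment> \<open>[v,u] = c^2 commutes with \<open>u\<close> and \<open>v\<close>; unique roots
    pass this on to \<open>c\<close>.\<close>
  have cu: "c \<otimes> u = u \<otimes> c"
    using c u v commutator_commute_right[OF v u] by (intro commute_square_root[OF c u]) (simp add: cc)
  have cv: "c \<otimes> v = v \<otimes> c"
    using c u v commutator_commute_left[OF v u] by (intro commute_square_root[OF c v]) (simp add: cc)
  let ?d = "c \<otimes> c \<otimes> c"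
  \<comment> \<open>The square of \<open>?d\<close> is [v,u]^3, which is central by Levi's identity;
    unique roots again give the claim for \<open>?d\<close>.\<close>
  have dz: "?d \<otimes> z = z \<otimes> ?d"
  proof (rule commute_square_root)
    have "?d \<otimes> ?d = (c \<otimes> c) \<otimes> (c \<otimes> c) \<otimes> (c \<otimes> c)"
      using c by (simp add: m_assoc)
    then show "?d \<otimes> ?d \<otimes> z = z \<otimes> (?d \<otimes> ?d)"
      using commutator_cube_commute[OF v u z] by (simp add: cc)
  qed (use c z in simp_all)
  have vu: "v \<otimes> u = u \<otimes> (v \<otimes> (c \<otimes> c))"
    using u v by (simp add: cc group_commutator_def m_assoc)
  have cu': "c \<otimes> (u \<otimes> w) = u \<otimes> (c \<otimes> w)" and cv': "c \<otimes> (v \<otimes> w) = v \<otimes> (c \<otimes> w)"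
    and vu': "v \<otimes> (u \<otimes> w) = u \<otimes> (v \<otimes> (c \<otimes> (c \<otimes> w)))"
    if "w \<in> carrier G" for w
  proof -
    show "c \<otimes> (u \<otimes> w) = u \<otimes> (c \<otimes> w)" "c \<otimes> (v \<otimes> w) = v \<otimes> (c \<otimes> w)"
      using c u v that cu cv by (simp_all flip: m_assoc)
    have "v \<otimes> (u \<otimes> w) = (v \<otimes> u) \<otimes> w"
      using u v that by (simp add: m_assoc)
    then show "v \<otimes> (u \<otimes> w) = u \<otimes> (v \<otimes> (c \<otimes> (c \<otimes> w)))"
      using c u v that by (simp add: vu m_assoc)
  qed
  \<comment> \<open>These rules bring words in \<open>u\<close>, \<open>v\<close>, \<open>c\<close>
    to the normal form u^i v^j c^k.\<close>
  note collect = m_assoc cu cu' cv cv' vu vu'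
  \<comment> \<open>This is \<open>circ G u v\<close>; its square is the product of u^2 and v^2, so
    \<open>circ_square\<close> applies to the outer product too.\<close>
  define t where "t = u \<otimes> v \<otimes> c"
  have t: "t \<in> carrier G"
    using c u v by (simp add: t_def)
  have tt: "u \<otimes> (v \<otimes> v) \<otimes> u = t \<otimes> t"
    using c u v by (simp add: t_def collect)
  have tu: "t \<otimes> u = u \<otimes> u \<otimes> v \<otimes> ?d"
    using c u v by (simp add: t_def collect)
  have dut: "?d \<otimes> (u \<otimes> t) = v \<otimes> u \<otimes> u"
    using c u v by (simp add: t_def collect)
  have "circ G (circ G (u \<otimes> u) (v \<otimes> v)) (circ G z (u \<otimes> u)) = t \<otimes> (u \<otimes> z \<otimes> u) \<otimes> t"
    using u v z t circ_commute[of z "u \<otimes> u"] by (simp add: circ_square tt)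
  also have "\<dots> = (t \<otimes> u) \<otimes> z \<otimes> (u \<otimes> t)"
    using t u z by (simp add: m_assoc)
  also have "\<dots> = u \<otimes> u \<otimes> v \<otimes> (?d \<otimes> z) \<otimes> (u \<otimes> t)"
    unfolding tu using c t u v z by (simp add: m_assoc)
  also have "\<dots> = u \<otimes> u \<otimes> v \<otimes> z \<otimes> (?d \<otimes> (u \<otimes> t))"
    unfolding dz using c t u v z by (simp add: m_assoc)
  also have "\<dots> = u \<otimes> (u \<otimes> (v \<otimes> z \<otimes> v) \<otimes> u) \<otimes> u"
    unfolding dut using u v z by (simp add: m_assoc)
  also have "\<dots> = circ G (u \<otimes> u) (circ G (circ G (v \<otimes> v) z) (u \<otimes> u))"
    using u v z circ_commute[of "v \<otimes> z \<otimes> v" "u \<otimes> u"] by (simp add: circ_square)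
  finally show ?thesis .
qed

lemma comm_moufang_loop_circ: "comm_moufang_loop (circ_loop G)"
proof -
  have division: "\<exists>!x. x \<in> carrier G \<and> circ G a x = b"
    if a: "a \<in> carrier G" and b: "b \<in> carrier G" for a b
  proof -
    obtain u where u: "u \<in> carrier G" and a_eq: "a = u \<otimes> u"
      using ex_square_root[OF a] by metis
    show ?thesis
    proof (rule ex1I)
      \<comment> \<open>For a = u^2 the equation reads uxu = b.\<close>
      show "inv u \<otimes> b \<otimes> inv u \<in> carrier G \<and> circ G a (inv u \<otimes> b \<otimes> inv u) = b"
        using u b by (simp add: a_eq circ_square m_assoc)
      show "x = inv u \<otimes> b \<otimes> inv u" if "x \<in> carrier G \<and> circ G a x = b" for x
      proof -
        have "x \<in> carrier G" "b = u \<otimes> x \<otimes> u"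
          using that u by (auto simp: a_eq circ_square)
        then show ?thesis
          using u by (simp add: m_assoc)
      qed
    qed
  qed
  show ?thesis
  proof (unfold_locales; unfold circ_loop_def monoid.simps partial_object.simps)
    show "circ G x \<one> = x" "circ G \<one> x = x" if "x \<in> carrier G" for x
      using that by (simp_all add: circ_of_commuting)
    show "\<exists>!y. y \<in> carrier G \<and> circ G y a = b" if "a \<in> carrier G" "b \<in> carrier G" for a b
      using division[OF that] circ_commute[of _ a] that(1) by metis
    \<comment> \<open>Only \<open>x\<close> and \<open>y\<close> are replaced by squares;
      \<open>z\<close> stays arbitrary.\<close>
    show "circ G (circ G x y) (circ G z x) = circ G x (circ G (circ G y z) x)"
      if "x \<in> carrier G" "y \<in> carrier G" "z \<in> carrier G" for x y z
      using that circ_moufang_squares ex_square_root[of x] ex_square_root[of y] by metis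
  qed (use division circ_commute in simp_all)
qed

end

theorem theorem2p9:
  fixes G :: "('a, 'b) monoid_scheme"
  assumes "group G"
    and "uniquely_2_divisible G"
  shows "two_Engel G \<longleftrightarrow> comm_moufang_loop (circ_loop G)"
proof -
  interpret group G by fact
  interpret uniquely_2_divisible_group G by unfold_locales fact
  show ?thesis
  proof
    assume "two_Engel G"
    then interpret uniquely_2_divisible_two_Engel_group G by unfold_locales
    show "comm_moufang_loop (circ_loop G)"
      by (rule comm_moufang_loop_circ)
  qed (rule two_Engel_of_moufang)
qed

end
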